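(* For algebras $(S;\cdot,\backslash,/)$ with three binary operations, the five identities (A1) $x\backslash(x\cdot y)=y$; (A2) $x\cdot(x\backslash y)=y$; (A3) $(x/y)\cdot y=(x\cdot y)/y$; (A4) $((x/y)\cdot y)/z=x/z$; (A5) $((x\cdot y)/z)\cdot z=x\cdot((y/z)\cdot z)$ are independent: for each $k\in\{1,2,3,4,5\}$ there is an algebra $(S;\cdot,\backslash,/)$ that satisfies the four identities (A$j$) with $j\neq k$ but does not satisfy (A$k$). *)

theory Defs
  imports Main "HOL-Library.FuncSet"
begin

(* \<oslash> is the operation / of the signature; / itself is the class-based field division.
   An algebra has an explicit carrier set, so that algebras of all finite and countably
   infinite sizes occur over the single type nat. *)
record 'a algebra =
  carrier :: "'a set"
  mul :: "'a \<Rightarrow> 'a \<Rightarrow> 'a"  (infixl \<open>\<cdot>\<index>\<close> 70)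
  ldiv :: "'a \<Rightarrow> 'a \<Rightarrow> 'a"  (infixl \<open>\<setminus>\<index>\<close> 70)
  rdiv :: "'a \<Rightarrow> 'a \<Rightarrow> 'a"  (infixl \<open>\<oslash>\<index>\<close> 70)

definition is_algebra :: "'a algebra \<Rightarrow> bool" where
  "is_algebra S \<longleftrightarrow>
     mul S \<in> carrier S \<rightarrow> carrier S \<rightarrow> carrier S \<and>
     ldiv S \<in> carrier S \<rightarrow> carrier S \<rightarrow> carrier S \<and>
     rdiv S \<in> carrier S \<rightarrow> carrier S \<rightarrow> carrier S"

datatype identity = A1 | A2 | A3 | A4 | A5

fun satisfies :: "'a algebra \<Rightarrow> identity \<Rightarrow> bool"  (infix \<open>\<Turnstile>\<close> 50) where
  "S \<Turnstile> A1 \<longleftrightarrow> (\<forall>x\<in>carrier S. \<forall>y\<in>carrier S.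
     x \<setminus>\<^bsub>S\<^esub> (x \<cdot>\<^bsub>S\<^esub> y) = y)"
| "S \<Turnstile> A2 \<longleftrightarrow> (\<forall>x\<in>carrier S. \<forall>y\<in>carrier S.
     x \<cdot>\<^bsub>S\<^esub> (x \<setminus>\<^bsub>S\<^esub> y) = y)"
| "S \<Turnstile> A3 \<longleftrightarrow> (\<forall>x\<in>carrier S. \<forall>y\<in>carrier S.
     (x \<oslash>\<^bsub>S\<^esub> y) \<cdot>\<^bsub>S\<^esub> y = (x \<cdot>\<^bsub>S\<^esub> y) \<oslash>\<^bsub>S\<^esub> y)"
| "S \<Turnstile> A4 \<longleftrightarrow> (\<forall>x\<in>carrier S. \<forall>y\<in>carrier S. \<forall>z\<in>carrier S.
     ((x \<oslash>\<^bsub>S\<^esub> y) \<cdot>\<^bsub>S\<^esub> y) \<oslash>\<^bsub>S\<^esub> z = x \<oslash>\<^bsub>S\<^esub> z)"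
| "S \<Turnstile> A5 \<longleftrightarrow> (\<forall>x\<in>carrier S. \<forall>y\<in>carrier S. \<forall>z\<in>carrier S.
     ((x \<cdot>\<^bsub>S\<^esub> y) \<oslash>\<^bsub>S\<^esub> z) \<cdot>\<^bsub>S\<^esub> z = x \<cdot>\<^bsub>S\<^esub> ((y \<oslash>\<^bsub>S\<^esub> z) \<cdot>\<^bsub>S\<^esub> z))"

end

theory Submission
  imports Defs
begin

text \<open>
  Write \<open>L x\<close> for left multiplication by \<open>x\<close> and \<open>E z\<close> for the map \<open>x \<mapsto> (x / z) \<cdot> z\<close>. The first two
  identities say that \<open>\<lambda>y. x \<setminus> y\<close> is a left, respectively right, inverse of \<open>L x\<close>; the last one says
  that every \<open>E z\<close> commutes with every \<open>L x\<close>. Two ways of trivialising these maps give one family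
  of algebras for each half of the problem.

  If every \<open>E z\<close> is the identity and every right multiplication is a bijection, then (A3)-(A5)
  hold for free, and the left multiplications remain to be chosen. On a group of exponent two this
  is achieved by \<open>x \<cdot> y = x + f y\<close>, where (A1) and (A2) become \<open>g \<circ> f = id\<close> and \<open>f \<circ> g = id\<close> for the
  map \<open>g\<close> used to define \<open>\<setminus>\<close>. Doubling and halving separate the two conditions. The carrier has to be
  infinite here, because on a finite set a one-sided inverse is two-sided. The natural numbers
  under bitwise exclusive or are such a group. This is \<open>xor_algebra_satisfies\<close>.

  If instead \<open>x \<cdot> y\<close> depends on \<open>y\<close> alone, through an involution \<open>p\<close>, then (A1) and (A2) hold for
  free, and every \<open>E z\<close> is constant with value \<open>p z\<close>. The identities (A3), (A4), (A5) then
  become three conditions on \<open>p\<close> and \<open>/\<close> that can be violated one at a time. This is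
  \<open>right_algebra_satisfies\<close>.
\<close>

unbundle bit_operations_syntax

definition xor_algebra :: "(nat \<Rightarrow> nat) \<Rightarrow> (nat \<Rightarrow> nat) \<Rightarrow> nat algebra" where
  "xor_algebra f g =
     \<lparr>carrier = UNIV, mul = \<lambda>x y. x XOR f y, ldiv = \<lambda>x y. g (x XOR y), rdiv = \<lambda>x y. x XOR f y\<rparr>"

definition right_algebra :: "('a \<Rightarrow> 'a) \<Rightarrow> ('a \<Rightarrow> 'a \<Rightarrow> 'a) \<Rightarrow> 'a algebra" where
  "right_algebra p d =
     \<lparr>carrier = UNIV, mul = \<lambda>x y. p y, ldiv = \<lambda>x y. p y, rdiv = d\<rparr>"

lemma is_algebra_xor_algebra: "is_algebra (xor_algebra f g)"
  by (simp add: is_algebra_def xor_algebra_def)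

lemma is_algebra_right_algebra: "is_algebra (right_algebra p d)"
  by (simp add: is_algebra_def right_algebra_def)

text \<open>
  Since \<open>x XOR x = 0\<close>, division on the right undoes multiplication on the right, so that
  \<open>(x / z) \<cdot> z = x = (x \<cdot> z) / z\<close>; this gives (A3)-(A5). In (A1) both occurrences of
  \<open>x\<close> cancel; in (A2) they do so after \<open>y\<close> is replaced by \<open>x XOR y\<close>.
\<close>
lemma xor_algebra_satisfies:
  "xor_algebra f g \<Turnstile> A1 \<longleftrightarrow> (\<forall>y. g (f y) = y)"
  "xor_algebra f g \<Turnstile> A2 \<longleftrightarrow> (\<forall>y. f (g y) = y)"
  "xor_algebra f g \<Turnstile> A3"
  "xor_algebra f g \<Turnstile> A4"
  "xor_algebra f g \<Turnstile> A5"
proof -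
  have cancel: "x XOR (x XOR y) = y" for x y :: nat
    by (simp flip: xor.assoc)
  show "xor_algebra f g \<Turnstile> A1 \<longleftrightarrow> (\<forall>y. g (f y) = y)"
    by (simp add: xor_algebra_def cancel)
  have "(\<forall>x y. x XOR f (g (x XOR y)) = y) \<longleftrightarrow> (\<forall>y. f (g y) = y)"
    by (metis cancel)
  then show "xor_algebra f g \<Turnstile> A2 \<longleftrightarrow> (\<forall>y. f (g y) = y)"
    by (simp add: xor_algebra_def)
qed (simp_all add: xor_algebra_def xor.assoc)

text \<open>
  Every product with right factor \<open>z\<close> equals \<open>p z\<close>, so the two sides of (A5) are \<open>p z\<close> and \<open>p (p z)\<close>,
  and (A4) compares \<open>d (p y) z\<close> with \<open>d x z\<close>, where \<open>p y\<close> is arbitrary because \<open>p\<close> is onto.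
\<close>
lemma right_algebra_satisfies:
  assumes "\<And>y. p (p y) = y"
  shows "right_algebra p d \<Turnstile> A1"
    and "right_algebra p d \<Turnstile> A2"
    and "right_algebra p d \<Turnstile> A3 \<longleftrightarrow> (\<forall>y. d (p y) y = p y)"
    and "right_algebra p d \<Turnstile> A4 \<longleftrightarrow> (\<forall>x y z. d x z = d y z)"
    and "right_algebra p d \<Turnstile> A5 \<longleftrightarrow> (\<forall>z. p z = z)"
proof -
  have "(\<forall>x y z. d (p y) z = d x z) \<longleftrightarrow> (\<forall>x y z. d x z = d y z)"
    by (metis assms)
  then show "right_algebra p d \<Turnstile> A4 \<longleftrightarrow> (\<forall>x y z. d x z = d y z)"
    by (simp add: right_algebra_def)
qed (auto simp: right_algebra_def assms)

theorem mainTheorem6: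
  shows "\<forall>k::identity. \<exists>S::nat algebra.
           is_algebra S \<and> (\<forall>j. j \<noteq> k \<longrightarrow> S \<Turnstile> j) \<and> \<not> S \<Turnstile> k"
proof
  fix k
  let ?double = "\<lambda>y::nat. 2 * y" and ?half = "\<lambda>y::nat. y div 2"
  have not_onto: "\<exists>y. 2 * (y div 2) \<noteq> (y::nat)"
    by (rule exI[of _ 1]) simp
  let ?flip = "\<lambda>y::nat. y XOR 1"
  have flip_flip: "?flip (?flip y) = y" for y
    by (simp add: xor.assoc)
  have flip_neq: "\<exists>y. ?flip y \<noteq> y"
    by (rule exI[of _ 0]) simp
  have two: "\<exists>x y. x \<noteq> (y::nat)"
    by (rule exI[of _ 0], rule exI[of _ 1]) simp
  show "\<exists>S::nat algebra. is_algebra S \<and> (\<forall>j. j \<noteq> k \<longrightarrow> S \<Turnstile> j) \<and> \<not> S \<Turnstile> k"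
  proof (cases k)
    case A1
    have "xor_algebra ?half ?double \<Turnstile> j \<longleftrightarrow> j \<noteq> k" for j
      using not_onto A1 by (cases j) (simp_all only: xor_algebra_satisfies, simp_all)
    then show ?thesis using is_algebra_xor_algebra by blast
  next
    case A2
    have "xor_algebra ?double ?half \<Turnstile> j \<longleftrightarrow> j \<noteq> k" for j
      using not_onto A2 by (cases j) (simp_all only: xor_algebra_satisfies, simp_all)
    then show ?thesis using is_algebra_xor_algebra by blast
  next
    case A3
    \<comment> \<open>With \<open>p = id\<close>, (A3) asks \<open>/\<close> to be idempotent, and the constant \<open>0\<close> is not.\<close>
    have "right_algebra id (\<lambda>x y. 0::nat) \<Turnstile> j \<longleftrightarrow> j \<noteq> k" for j
      using A3 by (cases j) (simp_all only: right_algebra_satisfies id_apply, auto)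
    then show ?thesis using is_algebra_right_algebra by blast
  next
    case A4
    have "right_algebra id (\<lambda>x y. x::nat) \<Turnstile> j \<longleftrightarrow> j \<noteq> k" for j
      using two A4 by (cases j) (simp_all only: right_algebra_satisfies id_apply, auto)
    then show ?thesis using is_algebra_right_algebra by blast
  next
    case A5
    \<comment> \<open>Here (A3) and (A4) together force \<open>x / y = p y\<close>.\<close>
    have "right_algebra ?flip (\<lambda>x y. ?flip y) \<Turnstile> j \<longleftrightarrow> j \<noteq> k" for j
      using flip_neq A5 by (cases j) (simp_all only: right_algebra_satisfies[OF flip_flip], auto)
    then show ?thesis using is_algebra_right_algebra by blast
  qed
qed

end
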